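(* Fix an integer $k \geq 3$. If a multiplicative function $g : \mathbb{N} \to \mathbb{C}$ satisfies \[ g(a_1^3 + a_2^3 + \cdots + a_k^3) = g(a_1)^3 + g(a_2)^3 + \cdots + g(a_k)^3 \] for all $a_1, a_2, \ldots, a_k \in \mathbb{N}$, then $g$ is the identity function, i.e. $g(n) = n$ for all $n \in \mathbb{N}$.
   Context: $\mathbb{N}$ denotes the set of positive integers. A function $g : \mathbb{N} \to \mathbb{C}$ is multiplicative if $g(1) = 1$ and $g(mn) = g(m) g(n)$ whenever $\gcd(m,n) = 1$. *)

theory Defs
  imports Complex_Main
begin

text \<open>
  A function on the positive integers is represented by a function on \<open>nat\<close>
  of which only the values at positive arguments matter.
\<close>

definition multiplicative :: "(nat \<Rightarrow> complex) \<Rightarrow> bool" where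
  "multiplicative g \<longleftrightarrow>
     g 1 = 1 \<and> (\<forall>m n. m > 0 \<longrightarrow> n > 0 \<longrightarrow> coprime m n \<longrightarrow> g (m * n) = g m * g n)"

end

theory Submission
  imports Defs "HOL-Number_Theory.Cong"
begin

text \<open>
  Padding with ones shows that \<open>G n = (g n)\<^sup>3\<close> turns every identity
  \<open>a\<^sup>3 + b\<^sup>3 + c\<^sup>3 = d\<^sup>3 + e\<^sup>3 + f\<^sup>3\<close> into \<open>G a + G b + G c = G d + G e + G f\<close>.
  Two linearly parametrised identities make such a \<open>G\<close> depend only on its values at 1, 2, 3, 4, so the
  solutions form the span of \<open>n\<^sup>3\<close>, \<open>1\<close> and the residues of \<open>n\<^sup>3\<close> modulo 9 and modulo 7 taken
  in \<open>{-1, 0, 1}\<close>. Multiplicativity leaves just these four functions, as in the independence of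
  characters, and \<open>G k = k\<^sup>3\<close> excludes the bounded ones. Hence \<open>(g n)\<^sup>3 = n\<^sup>3\<close>, and \<open>g s = s\<close>
  for every sum \<open>s\<close> of \<open>k\<close> positive cubes. To remove the remaining cube root of unity at \<open>n\<close>, one
  finds \<open>m\<close> coprime to \<open>n\<close> with \<open>g m = m\<close> such that \<open>n * m\<close> is a sum of \<open>k\<close> positive cubes. For
  \<open>n\<close> prime to 3 this comes from Ryley's representation of a rational number as a sum of three
  rational cubes; for powers of 3 it is elementary.
\<close>

section \<open>Linear relations forced by equal sums of three cubes\<close>

text \<open>The value type is generic because integer residues, real components and the complex
  function \<open>G\<close> all occur.\<close>

definition respects_cube_relations :: "(nat \<Rightarrow> 'a::ab_group_add) \<Rightarrow> bool" where
  "respects_cube_relations F \<longleftrightarrow>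
     (\<forall>a b c d e f. a > 0 \<longrightarrow> b > 0 \<longrightarrow> c > 0 \<longrightarrow> d > 0 \<longrightarrow> e > 0 \<longrightarrow> f > 0 \<longrightarrow>
        a ^ 3 + b ^ 3 + c ^ 3 = d ^ 3 + e ^ 3 + f ^ 3 \<longrightarrow> F a + F b + F c = F d + F e + F f)"

lemma respects_cube_relationsD:
  assumes "respects_cube_relations F" "a ^ 3 + b ^ 3 + c ^ 3 = d ^ 3 + e ^ 3 + f ^ 3"
    and "a > 0" "b > 0" "c > 0" "d > 0" "e > 0" "f > 0"
  shows "F a + F b + F c = F d + F e + F f"
  using assms unfolding respects_cube_relations_def by blast

text \<open>For \<open>0 < j < 5\<close> and \<open>t \<ge> 3\<close> the base
  \<open>5 * t + j\<close> exceeds the other five, so the value at \<open>n = 5 * t + j\<close> is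
  determined by values at smaller arguments.\<close>

lemma cube_identity_step:
  fixes t j :: nat
  assumes "j \<le> 3 * t"
  shows "(t + 2 * j) ^ 3 + (3 * t - j) ^ 3 + (5 * t + j) ^ 3 = t ^ 3 + (3 * t + 2 * j) ^ 3 + (5 * t) ^ 3"
proof -
  obtain u where u: "3 * t = j + u" using assms le_Suc_ex by blast
  then have "int u = 3 * int t - int j" by linarith
  then have "(int t + 2 * int j) ^ 3 + int u ^ 3 + (5 * int t + int j) ^ 3
      = int t ^ 3 + (3 * int t + 2 * int j) ^ 3 + (5 * int t) ^ 3"
    by algebra
  then have "int ((t + 2 * j) ^ 3 + u ^ 3 + (5 * t + j) ^ 3) = int (t ^ 3 + (3 * t + 2 * j) ^ 3 + (5 * t) ^ 3)"
    by simp
  then show ?thesis using u by (simp only: of_nat_eq_iff add_diff_cancel_left')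
qed

text \<open>Covers \<open>j = 0\<close>, where \<open>cube_identity_step\<close> is trivial; again
  \<open>5 * t\<close> is the largest base. Positivity of \<open>t - 2\<close> needs
  \<open>t \<ge> 3\<close>, so the recursion starts at 15.\<close>

lemma cube_identity_multiple_of_5:
  fixes t :: nat
  assumes "t \<ge> 2"
  shows "t ^ 3 + (3 * t - 2) ^ 3 + (5 * t) ^ 3 = (t - 2) ^ 3 + (3 * t + 1) ^ 3 + (5 * t - 1) ^ 3"
proof -
  obtain u where u: "t = u + 2" using assms by (metis add.commute le_Suc_ex)
  show ?thesis unfolding u by (simp add: power3_eq_cube algebra_simps)
qed

text \<open>Strong induction: the two identities settle \<open>n \<ge> 15\<close>, and explicit
  relations give a linear system below 15. Real values suit \<open>linarith\<close>; the complex
  case follows componentwise.\<close>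

lemma respects_cube_relations_real_eq_0:
  fixes H :: "nat \<Rightarrow> real"
  assumes H: "respects_cube_relations H"
    and init: "H 1 = 0" "H 2 = 0" "H 3 = 0" "H 4 = 0"
    and "n > 0"
  shows "H n = 0"
  using \<open>n > 0\<close>
proof (induction n rule: less_induct)
  case (less n)
  note R = respects_cube_relationsD[OF H]
  show ?case
  proof (cases "n < 15")
    case True
    have rels:
      "H 1 + H 5 + H 5 = H 2 + H 3 + H 6" "H 1 + H 2 + H 10 = H 4 + H 6 + H 9"
      "H 1 + H 5 + H 11 = H 6 + H 8 + H 9" "H 1 + H 9 + H 9 = H 4 + H 4 + H 11"
      "H 1 + H 1 + H 12 = H 1 + H 9 + H 10" "H 2 + H 3 + H 12 = H 6 + H 6 + H 11"
      "H 1 + H 6 + H 13 = H 7 + H 7 + H 12" "H 2 + H 10 + H 12 = H 3 + H 8 + H 13"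
      "H 1 + H 6 + H 15 = H 4 + H 11 + H 13" "H 1 + H 10 + H 14 = H 3 + H 7 + H 15"
      "H 2 + H 2 + H 15 = H 9 + H 11 + H 11"
      by (rule R; simp)+
    have small: "n = 1 \<or> n = 2 \<or> n = 3 \<or> n = 4 \<or> n = 5 \<or> n = 6 \<or> n = 7 \<or> n = 8
        \<or> n = 9 \<or> n = 10 \<or> n = 11 \<or> n = 12 \<or> n = 13 \<or> n = 14"
      using True less.prems by presburger
    have h56: "H 5 = 0" "H 6 = 0"
      using rels(1,2,4-6) init by linarith+
    have h9: "H 10 = H 9" "H 11 = 2 * H 9" "H 12 = 2 * H 9" "H 8 = H 9"
      using rels(2-5) h56 init by linarith+
    have h7: "H 13 = 2 * H 9" "H 7 = 0"
      using rels(7,8) h56 h9 init by linarith+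
    \<comment> \<open>\<open>H 15\<close> is an auxiliary unknown: \<open>rels(9)\<close> makes it
      \<open>4 * H 9\<close>, \<open>rels(11)\<close> makes it \<open>5 * H 9\<close>, so
      \<open>H 9 = 0\<close>.\<close>
    have "H 9 = 0" "H 14 = 0"
      using rels(9-11) h56 h9 h7 init by linarith+
    with h56 h9 h7 init have z: "\<forall>m\<in>{1, 2, 3, 4, 5, 6, 7, 8, 9, 10, 11, 12, 13, 14}. H m = 0"
      by simp
    show ?thesis using small z by blast
  next
    case False
    define t j where "t = n div 5" and "j = n mod 5"
    have n: "n = 5 * t + j" and t: "t \<ge> 3" and j: "j < 5"
      using False by (auto simp: t_def j_def)
    show ?thesis
    proof (cases "j = 0")
      case True
      have "H t + H (3 * t - 2) + H (5 * t) = H (t - 2) + H (3 * t + 1) + H (5 * t - 1)"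
        by (rule R[OF cube_identity_multiple_of_5]) (use t in auto)
      moreover have "H t = 0" "H (3 * t - 2) = 0" "H (t - 2) = 0" "H (3 * t + 1) = 0" "H (5 * t - 1) = 0"
        by (rule less.IH; use n t True in linarith)+
      ultimately show ?thesis using n True by simp
    next
      case False
      have "H (t + 2 * j) + H (3 * t - j) + H (5 * t + j) = H t + H (3 * t + 2 * j) + H (5 * t)"
        by (rule R[OF cube_identity_step]) (use t j in auto)
      moreover have "H (t + 2 * j) = 0" "H (3 * t - j) = 0" "H t = 0" "H (3 * t + 2 * j) = 0" "H (5 * t) = 0"
        by (rule less.IH; use n t j False in linarith)+
      ultimately show ?thesis using n by simp
    qed
  qed
qed

lemma respects_cube_relations_unique:
  fixes F G :: "nat \<Rightarrow> complex"
  assumes F: "respects_cube_relations F" and G: "respects_cube_relations G"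
    and init: "F 1 = G 1" "F 2 = G 2" "F 3 = G 3" "F 4 = G 4"
    and "n > 0"
  shows "F n = G n"
proof -
  have "respects_cube_relations (\<lambda>n. Re (F n) - Re (G n)) \<and> respects_cube_relations (\<lambda>n. Im (F n) - Im (G n))"
    unfolding respects_cube_relations_def
  proof (intro conjI allI impI, goal_cases)
    case (1 a b c d e f)
    have "Re (F a + F b + F c) = Re (F d + F e + F f)" "Re (G a + G b + G c) = Re (G d + G e + G f)"
      using respects_cube_relationsD[OF F] respects_cube_relationsD[OF G] 1 by metis+
    then show ?case by simp
  next
    case (2 a b c d e f)
    have "Im (F a + F b + F c) = Im (F d + F e + F f)" "Im (G a + G b + G c) = Im (G d + G e + G f)"
      using respects_cube_relationsD[OF F] respects_cube_relationsD[OF G] 2 by metis+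
    then show ?case by simp
  qed
  then have "Re (F n) - Re (G n) = 0" "Im (F n) - Im (G n) = 0"
    using init \<open>n > 0\<close>
      respects_cube_relations_real_eq_0[of "\<lambda>n. Re (F n) - Re (G n)" n]
      respects_cube_relations_real_eq_0[of "\<lambda>n. Im (F n) - Im (G n)" n] by simp_all
  then show ?thesis by (simp add: complex_eq_iff)
qed

section \<open>Cubes modulo 7 and 9\<close>

text \<open>For \<open>q = 7\<close> and \<open>q = 9\<close> the cubes modulo \<open>q\<close> are \<open>-1, 0, 1\<close>, and this is the representative in that set.\<close>

definition cube_residue :: "nat \<Rightarrow> nat \<Rightarrow> int" where
  "cube_residue q n = int ((n ^ 3 + 1) mod q) - 1"

lemma cube_residue_bound:
  assumes "q = 7 \<or> q = 9"
  shows "\<bar>cube_residue q n\<bar> \<le> 1"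
proof -
  have eq: "(n ^ 3 + 1) mod q = ((n mod q) ^ 3 + 1) mod q"
    by (metis mod_add_left_eq power_mod)
  have "n mod q < q" using assms by auto
  then have "n mod q \<in> {0, 1, 2, 3, 4, 5, 6} \<or> q = 9 \<and> n mod q \<in> {7, 8}"
    using assms by auto
  then show ?thesis
    using assms unfolding cube_residue_def eq by auto
qed

lemma cong_cube_residue: "[cube_residue q n = int n ^ 3] (mod int q)"
proof -
  have "[int ((n ^ 3 + 1) mod q) - 1 = int (n ^ 3 + 1) - 1] (mod int q)"
    by (intro cong_diff cong_refl) (simp add: cong_def of_nat_mod)
  then show ?thesis by (simp add: cube_residue_def)
qed

lemma respects_cube_relations_cube_residue:
  assumes q: "q = 7 \<or> q = 9"
  shows "respects_cube_relations (cube_residue q)"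
  unfolding respects_cube_relations_def
proof (intro allI impI)
  fix a b c d e f :: nat
  assume eq: "a ^ 3 + b ^ 3 + c ^ 3 = d ^ 3 + e ^ 3 + f ^ 3"
  let ?r = "cube_residue q"
  \<comment> \<open>Both sums lie in \<open>{-3..3}\<close>, so congruence modulo \<open>q \<ge> 7\<close> forces equality.\<close>
  have "[?r a + ?r b + ?r c = int a ^ 3 + int b ^ 3 + int c ^ 3] (mod int q)"
    by (intro cong_add cong_cube_residue)
  also have "int a ^ 3 + int b ^ 3 + int c ^ 3 = int d ^ 3 + int e ^ 3 + int f ^ 3"
    using arg_cong[OF eq, of int] by simp
  also have "[int d ^ 3 + int e ^ 3 + int f ^ 3 = ?r d + ?r e + ?r f] (mod int q)"
    by (intro cong_add cong_sym[OF cong_cube_residue])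
  finally have "int q dvd (?r a + ?r b + ?r c) - (?r d + ?r e + ?r f)"
    by (simp add: cong_iff_dvd_diff)
  moreover have "\<bar>(?r a + ?r b + ?r c) - (?r d + ?r e + ?r f)\<bar> < int q"
    using cube_residue_bound[OF q, of a] cube_residue_bound[OF q, of b] cube_residue_bound[OF q, of c]
      cube_residue_bound[OF q, of d] cube_residue_bound[OF q, of e] cube_residue_bound[OF q, of f] q
    by linarith
  ultimately have "(?r a + ?r b + ?r c) - (?r d + ?r e + ?r f) = 0"
    using zdvd_not_zless by (metis dvd_abs_iff zero_less_abs_iff)
  then show "?r a + ?r b + ?r c = ?r d + ?r e + ?r f" by simp
qed

section \<open>The solution space and its multiplicative members\<close>

lemma respects_cube_relations_combination:
  fixes \<alpha> \<beta> \<gamma> \<delta> :: complex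
  shows "respects_cube_relations
    (\<lambda>n. \<alpha> + \<beta> * of_nat n ^ 3 + \<gamma> * of_int (cube_residue 9 n) + \<delta> * of_int (cube_residue 7 n))"
  unfolding respects_cube_relations_def
proof (intro allI impI)
  fix a b c d e f :: nat
  assume pos: "a > 0" "b > 0" "c > 0" "d > 0" "e > 0" "f > 0"
    and eq: "a ^ 3 + b ^ 3 + c ^ 3 = d ^ 3 + e ^ 3 + f ^ 3"
  let ?m = "\<lambda>n. of_nat n ^ 3 :: complex"
  let ?r = "\<lambda>n. of_int (cube_residue 9 n) :: complex" and ?s = "\<lambda>n. of_int (cube_residue 7 n) :: complex"
  let ?T = "\<lambda>F::nat \<Rightarrow> complex. F a + F b + F c - F d - F e - F f"
  have m: "?T ?m = 0"
    using arg_cong[OF eq, of "of_nat :: nat \<Rightarrow> complex"] by simp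
  have rs: "?T ?r = 0" "?T ?s = 0"
    using respects_cube_relationsD[OF respects_cube_relations_cube_residue eq pos, of 9,
        THEN arg_cong, of "of_int :: int \<Rightarrow> complex"]
      respects_cube_relationsD[OF respects_cube_relations_cube_residue eq pos, of 7,
        THEN arg_cong, of "of_int :: int \<Rightarrow> complex"]
    by simp_all
  let ?F = "\<lambda>n. \<alpha> + \<beta> * ?m n + \<gamma> * ?r n + \<delta> * ?s n"
  have "?T ?F = \<beta> * ?T ?m + \<gamma> * ?T ?r + \<delta> * ?T ?s"
    by (simp add: algebra_simps)
  also have "\<dots> = 0" by (simp only: m rs) simp
  finally show "?F a + ?F b + ?F c = ?F d + ?F e + ?F f"
    by (simp add: algebra_simps)
qed

lemma respects_cube_relations_form:
  fixes G :: "nat \<Rightarrow> complex"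
  assumes "respects_cube_relations G"
  obtains \<alpha> \<beta> \<gamma> \<delta> where
    "\<And>n. n > 0 \<Longrightarrow> G n = \<alpha> + \<beta> * of_nat n ^ 3 + \<gamma> * of_int (cube_residue 9 n) + \<delta> * of_int (cube_residue 7 n)"
proof -
  \<comment> \<open>Interpolation at 1, 2, 3, 4, where the residues are 1, -1, 0, 1 modulo 9 and 1,
    1, -1, 1 modulo 7. Both agree at 1 and 4, which isolates \<open>\<beta>\<close>; then 2 gives
    \<open>\<gamma>\<close> and 3 gives \<open>\<delta>\<close>.\<close>
  define \<beta> where "\<beta> = (G 4 - G 1) / 63"
  define \<gamma> where "\<gamma> = (7 * \<beta> - (G 2 - G 1)) / 2"
  define \<delta> where "\<delta> = (26 * \<beta> - \<gamma> - (G 3 - G 1)) / 2"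
  define \<alpha> where "\<alpha> = G 1 - \<beta> - \<gamma> - \<delta>"
  have "G n = \<alpha> + \<beta> * of_nat n ^ 3 + \<gamma> * of_int (cube_residue 9 n) + \<delta> * of_int (cube_residue 7 n)"
    if "n > 0" for n
    by (rule respects_cube_relations_unique[OF assms respects_cube_relations_combination _ _ _ _ that])
      (simp_all add: cube_residue_def \<alpha>_def \<delta>_def \<gamma>_def \<beta>_def field_simps)
  then show ?thesis using that by blast
qed

text \<open>The matrix holds the values of the four basis functions at 1, 2, 3, 4; it is
  nonsingular, so they are linearly independent.\<close>

lemma coefficients_eq_0:
  fixes a b c d :: complex
  assumes "a + b + c + d = 0" "a + 8 * b - c + d = 0" "a + 27 * b - d = 0" "a + 64 * b + c + d = 0"
  shows "a = 0 \<and> b = 0 \<and> c = 0 \<and> d = 0"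
  using assms unfolding complex_eq_iff by simp

text \<open>Passing from \<open>n\<close> to \<open>5 * n\<close> scales the basis functions by 1,
  125, -1, -1, and to \<open>7 * n\<close> by 1, 343, 1, 0. Multiplicativity scales \<open>G\<close>
  by \<open>G 5\<close> or \<open>G 7\<close> at 1, 2, 3, 4, and independence allows comparing
  coefficients.\<close>

lemma multiplicative_respects_cube_relations:
  fixes G :: "nat \<Rightarrow> complex"
  assumes rel: "respects_cube_relations G" and one: "G 1 = 1"
    and mult: "\<And>m n. m > 0 \<Longrightarrow> n > 0 \<Longrightarrow> coprime m n \<Longrightarrow> G (m * n) = G m * G n"
  shows "(\<forall>n>0. G n = of_nat n ^ 3) \<or> (\<forall>n>0. norm (G n) \<le> 1)"
proof -
  obtain \<alpha> \<beta> \<gamma> \<delta> where form: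
    "\<And>n. n > 0 \<Longrightarrow> G n = \<alpha> + \<beta> * of_nat n ^ 3 + \<gamma> * of_int (cube_residue 9 n) + \<delta> * of_int (cube_residue 7 n)"
    using respects_cube_relations_form[OF rel] by blast
  have sum: "\<alpha> + \<beta> + \<gamma> + \<delta> = 1"
    using form[of 1] one by (simp add: cube_residue_def)
  have small: "G 2 = \<alpha> + 8 * \<beta> - \<gamma> + \<delta>" "G 3 = \<alpha> + 27 * \<beta> - \<delta>" "G 4 = \<alpha> + 64 * \<beta> + \<gamma> + \<delta>"
    by (simp_all add: form cube_residue_def)
  have cop5: "coprime 5 (2::nat)" "coprime 5 (3::nat)" "coprime 5 (4::nat)"
    and cop7: "coprime 7 (2::nat)" "coprime 7 (3::nat)" "coprime 7 (4::nat)"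
    by (simp_all add: coprime_iff_gcd_eq_1 gcd_non_0_nat)
  have G5: "G 5 = \<alpha> + 125 * \<beta> - \<gamma> - \<delta>" "G 10 = \<alpha> + 1000 * \<beta> + \<gamma> - \<delta>"
      "G 15 = \<alpha> + 3375 * \<beta> + \<delta>" "G 20 = \<alpha> + 8000 * \<beta> - \<gamma> - \<delta>"
    by (simp_all add: form cube_residue_def)
  have M5: "G 10 = G 5 * G 2" "G 15 = G 5 * G 3" "G 20 = G 5 * G 4"
    using mult[OF _ _ cop5(1)] mult[OF _ _ cop5(2)] mult[OF _ _ cop5(3)] by simp_all
  have e5: "\<alpha> * (1 - G 5) = 0 \<and> \<beta> * (125 - G 5) = 0 \<and> \<gamma> * (- 1 - G 5) = 0 \<and> \<delta> * (- 1 - G 5) = 0"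
  proof (rule coefficients_eq_0)
    have "\<alpha> * (1 - G 5) + \<beta> * (125 - G 5) + \<gamma> * (- 1 - G 5) + \<delta> * (- 1 - G 5) =
        (\<alpha> + 125 * \<beta> - \<gamma> - \<delta>) - G 5 * (\<alpha> + \<beta> + \<gamma> + \<delta>)"
      by (simp add: algebra_simps)
    also have "\<dots> = 0" unfolding sum G5(1)[symmetric] by simp
    finally show "\<alpha> * (1 - G 5) + \<beta> * (125 - G 5) + \<gamma> * (- 1 - G 5) + \<delta> * (- 1 - G 5) = 0" .
  qed (use M5 small G5(2-4) in \<open>simp_all add: algebra_simps\<close>)
  have G7: "G 7 = \<alpha> + 343 * \<beta> + \<gamma>" "G 14 = \<alpha> + 2744 * \<beta> - \<gamma>"
      "G 21 = \<alpha> + 9261 * \<beta>" "G 28 = \<alpha> + 21952 * \<beta> + \<gamma>"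
    by (simp_all add: form cube_residue_def)
  have M7: "G 14 = G 7 * G 2" "G 21 = G 7 * G 3" "G 28 = G 7 * G 4"
    using mult[OF _ _ cop7(1)] mult[OF _ _ cop7(2)] mult[OF _ _ cop7(3)] by simp_all
  have e7: "\<alpha> * (1 - G 7) = 0 \<and> \<beta> * (343 - G 7) = 0 \<and> \<gamma> * (1 - G 7) = 0 \<and> \<delta> * (0 - G 7) = 0"
  proof (rule coefficients_eq_0)
    have "\<alpha> * (1 - G 7) + \<beta> * (343 - G 7) + \<gamma> * (1 - G 7) + \<delta> * (0 - G 7) =
        (\<alpha> + 343 * \<beta> + \<gamma>) - G 7 * (\<alpha> + \<beta> + \<gamma> + \<delta>)"
      by (simp add: algebra_simps)
    also have "\<dots> = 0" unfolding sum G7(1)[symmetric] by simp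
    finally show "\<alpha> * (1 - G 7) + \<beta> * (343 - G 7) + \<gamma> * (1 - G 7) + \<delta> * (0 - G 7) = 0" .
  qed (use M7 small G7(2-4) in \<open>simp_all add: algebra_simps\<close>)
  have bound: "norm (of_int (cube_residue q n) :: complex) \<le> 1" if "q = 7 \<or> q = 9" for q n
    using cube_residue_bound[OF that, of n] by simp
  \<comment> \<open>The factors at 5 separate \<open>\<beta>\<close> and \<open>\<alpha>\<close>
    from all others; those at 7 separate \<open>\<gamma>\<close> from \<open>\<delta>\<close>. The
    surviving coefficient is 1 by \<open>sum\<close>.\<close>
  consider "\<beta> = 1" "\<alpha> = 0" "\<gamma> = 0" "\<delta> = 0" | "\<alpha> = 1" "\<beta> = 0" "\<gamma> = 0" "\<delta> = 0"
    | "\<gamma> = 1" "\<alpha> = 0" "\<beta> = 0" "\<delta> = 0" | "\<delta> = 1" "\<alpha> = 0" "\<beta> = 0" "\<gamma> = 0"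
  proof (cases "\<beta> = 0")
    case False
    then have "G 5 = 125" using e5 by simp
    then have "\<alpha> = 0" "\<gamma> = 0" "\<delta> = 0" using e5 by simp_all
    then show ?thesis using sum that(1) by simp
  next
    case \<beta>: True
    show ?thesis
    proof (cases "\<alpha> = 0")
      case False
      then have "G 5 = 1" using e5 by simp
      then have "\<gamma> = 0" "\<delta> = 0" using e5 by simp_all
      then show ?thesis using sum \<beta> that(2) by simp
    next
      case \<alpha>: True
      show ?thesis
      proof (cases "\<gamma> = 0")
        case False
        then have "G 7 = 1" using e7 by simp
        then have "\<delta> = 0" using e7 by simp
        then show ?thesis using sum \<alpha> \<beta> that(3) by simp
      next
        case True
        then show ?thesis using sum \<alpha> \<beta> that(4) by simp
      qed
    qed
  qed
  then show ?thesis using form bound by cases simp_all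
qed

section \<open>Sums of exactly k positive cubes\<close>

text \<open>The inductive form lets summands be appended singly;
  \<open>cube_sum_imp_ex_function\<close> recovers the indexed sum of the theorem.\<close>

inductive cube_sum :: "nat \<Rightarrow> nat \<Rightarrow> bool" where
  zero: "cube_sum 0 0"
| Suc: "x > 0 \<Longrightarrow> cube_sum k s \<Longrightarrow> cube_sum (Suc k) (s + x ^ 3)"

lemma cube_sum_imp_ex_function:
  assumes "cube_sum k s"
  shows "\<exists>a. (\<forall>i\<in>{1..k}. a i > 0) \<and> s = (\<Sum>i = 1..k. a i ^ 3)"
  using assms
proof induction
  case zero
  show ?case by simp
next
  case (Suc x k s)
  then obtain a where a: "\<forall>i\<in>{1..k}. a i > 0" "s = (\<Sum>i = 1..k. a i ^ 3)" by blast
  have "(\<Sum>i = 1..k. (a(Suc k := x)) i ^ 3) = (\<Sum>i = 1..k. a i ^ 3)"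
    by (rule sum.cong) auto
  with a Suc.hyps show ?case
    by (intro exI[of _ "a(Suc k := x)"]) auto
qed

lemma cube_sum_scale:
  assumes "cube_sum k s" "c > 0"
  shows "cube_sum k (s * c ^ 3)"
  using assms(1)
proof induction
  case zero
  show ?case using cube_sum.zero by simp
next
  case (Suc x k s)
  then show ?case
    using cube_sum.Suc[of "x * c" k "s * c ^ 3"] \<open>c > 0\<close> by (simp add: algebra_simps power_mult_distrib)
qed

lemma cube_sum_replicate:
  assumes "x > 0"
  shows "cube_sum k (k * x ^ 3)"
proof (induction k)
  case (Suc k)
  then show ?case using cube_sum.Suc[OF assms Suc] by (simp add: add.commute)
qed (simp add: cube_sum.zero)

lemma cube_sum_add3:
  assumes "cube_sum k s" "x > 0" "y > 0" "z > 0"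
  shows "cube_sum (k + 3) (s + x ^ 3 + y ^ 3 + z ^ 3)"
  using cube_sum.Suc[OF assms(4) cube_sum.Suc[OF assms(3) cube_sum.Suc[OF assms(2,1)]]]
  by (simp add: numeral_3_eq_3)

text \<open>Since \<open>1 + 6^3 + 8^3 = 9^3\<close>, two more cubes turn a cubed power of 3 into
  another, so the cases 3 and 4 suffice.\<close>

lemma cube_sum_power_of_3_cubed:
  assumes "k \<ge> 3"
  shows "\<exists>j. cube_sum k ((3 ^ j) ^ 3)"
  using assms
proof (induction k rule: less_induct)
  case (less k)
  consider "k = 3" | "k = 4" | "k \<ge> 5" using less.prems by linarith
  then show ?case
  proof cases
    case 1
    have "cube_sum (0 + 3) (0 + 1 ^ 3 + 6 ^ 3 + 8 ^ 3)"
      by (intro cube_sum_add3 cube_sum.zero) auto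
    then show ?thesis using 1 by (intro exI[of _ 2]) simp
  next
    case 2
    \<comment> \<open>The four cubes add up to \<open>81^3\<close>.\<close>
    have "cube_sum (Suc 0 + 3) ((0 + 21 ^ 3) + 8 ^ 3 + 73 ^ 3 + 51 ^ 3)"
      by (intro cube_sum_add3 cube_sum.zero cube_sum.Suc) auto
    then show ?thesis using 2 by (intro exI[of _ 4]) simp
  next
    case 3
    define l where "l = k - 2"
    have l: "k = Suc (Suc l)" "l \<ge> 3" using 3 by (auto simp: l_def)
    then obtain j where j: "cube_sum l ((3 ^ j) ^ 3)" using less.IH[of l] by auto
    have "cube_sum k ((3 ^ j) ^ 3 + (6 * 3 ^ j) ^ 3 + (8 * 3 ^ j) ^ 3)"
      unfolding l by (intro cube_sum.Suc j) auto
    also have "(3 ^ j) ^ 3 + (6 * 3 ^ j) ^ 3 + (8 * 3 ^ j) ^ 3 = ((3 ^ (j + 2)) ^ 3 :: nat)"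
      by (simp add: power_mult_distrib power_add)
    finally show ?thesis by blast
  qed
qed

section \<open>Ryley's identity and multiples that are sums of cubes\<close>

text \<open>The first base is \<open>A^3 - 729 * B^3\<close> in factored form, positive as
  \<open>9 * B < A\<close>; the bound \<open>A < 16 * B\<close> makes the second,
  \<open>243 * A * B^2 + 729 * B^3 - A^3\<close>, positive.\<close>

lemma ryley_identity:
  fixes A B :: nat
  assumes "9 * B < A" "A < 16 * B"
  shows "\<exists>x>0. \<exists>y>0. \<exists>z>0. A * B ^ 2 * (9 * (A ^ 2 + 9 * A * B + 81 * B ^ 2)) ^ 3 = x ^ 3 + y ^ 3 + z ^ 3"
proof -
  have "B > 0" "A > 0" using assms by auto
  obtain u where u: "A = 9 * B + u" "u > 0"
    using assms(1) less_imp_add_positive by blast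
  \<comment> \<open>Split \<open>256 = 243 + 13\<close>: the excess \<open>13 * A * B^2\<close> is
    at most \<open>208 * B^3\<close>, below \<open>729 * B^3\<close>.\<close>
  have "A ^ 2 < (16 * B) ^ 2" using assms(2) by (intro power_strict_mono) auto
  then have "A * A ^ 2 \<le> A * (256 * B ^ 2)" by (simp add: power_mult_distrib)
  moreover have "A * (13 * B ^ 2) \<le> 16 * B * (13 * B ^ 2)" using assms(2) by (intro mult_right_mono) auto
  moreover have "0 < B ^ 3" using \<open>B > 0\<close> by simp
  moreover have "A * (256 * B ^ 2) = 243 * A * B ^ 2 + A * (13 * B ^ 2)" "16 * B * (13 * B ^ 2) = 208 * B ^ 3"
    by (simp_all add: power3_eq_cube power2_eq_square)
  moreover have "A ^ 3 = A * A ^ 2" by (simp add: power3_eq_cube power2_eq_square)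
  ultimately have "A ^ 3 < 243 * A * B ^ 2 + 729 * B ^ 3" by linarith
  then obtain y where y: "A ^ 3 + y = 243 * A * B ^ 2 + 729 * B ^ 3" "y > 0"
    using less_imp_add_positive by metis
  have yi: "int y = 243 * int A * int B ^ 2 + 729 * int B ^ 3 - int A ^ 3"
    using arg_cong[OF y(1), of int] by simp
  have ui: "int u = int A - 9 * int B" using u by simp
  have "int A * int B ^ 2 * (9 * (int A ^ 2 + 9 * int A * int B + 81 * int B ^ 2)) ^ 3 =
      (int u * (int A ^ 2 + 9 * int A * int B + 81 * int B ^ 2)) ^ 3 + int y ^ 3
      + (27 * int A ^ 2 * int B + 243 * int A * int B ^ 2) ^ 3"
    unfolding yi ui by algebra
  then have "int (A * B ^ 2 * (9 * (A ^ 2 + 9 * A * B + 81 * B ^ 2)) ^ 3) =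
      int ((u * (A ^ 2 + 9 * A * B + 81 * B ^ 2)) ^ 3 + y ^ 3 + (27 * A ^ 2 * B + 243 * A * B ^ 2) ^ 3)"
    by simp
  then have "A * B ^ 2 * (9 * (A ^ 2 + 9 * A * B + 81 * B ^ 2)) ^ 3 =
      (u * (A ^ 2 + 9 * A * B + 81 * B ^ 2)) ^ 3 + y ^ 3 + (27 * A ^ 2 * B + 243 * A * B ^ 2) ^ 3"
    by (simp only: of_nat_eq_iff)
  moreover have "u * (A ^ 2 + 9 * A * B + 81 * B ^ 2) > 0" "27 * A ^ 2 * B + 243 * A * B ^ 2 > 0"
    using u(2) \<open>A > 0\<close> \<open>B > 0\<close> by auto
  ultimately show ?thesis using y(2) by blast
qed

lemma coprime_Suc_mult_left: "coprime (n * i + 1) (n::nat)"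
  by (metis coprime_1_left coprime_iff_gcd_eq_1 gcd_add_mult gcd.commute mult.commute add.commute)

text \<open>Both numbers are taken congruent to 1 modulo \<open>n\<close>. With \<open>p\<close>
  large, one step of size \<open>n\<close> changes \<open>q^3\<close> by a factor below
  \<open>16 / 9\<close>, so the least \<open>q\<close> meeting the upper bound also meets the lower
  one.\<close>

lemma ex_coprime_cube_ratio:
  fixes M n :: nat
  assumes "M > 0" "n > 0"
  shows "\<exists>p q. p > 0 \<and> q > 0 \<and> coprime p n \<and> coprime q n \<and> 9 * q ^ 3 < M * p ^ 3 \<and> M * p ^ 3 < 16 * q ^ 3"
proof -
  define p where "p = n * 20 + 1"
  define j where "j = (LEAST j. M * p ^ 3 < 16 * (n * j + 1) ^ 3)"
  define q where "q = n * j + 1"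
  have "M * p ^ 3 \<le> 1 * (n * (M * p ^ 3) + 1) ^ 1" using \<open>n > 0\<close> by (simp add: le_SucI)
  also have "\<dots> < 16 * (n * (M * p ^ 3) + 1) ^ 3"
    by (intro mult_less_le_imp_less power_increasing) auto
  finally have ub: "M * p ^ 3 < 16 * q ^ 3"
    unfolding q_def j_def by (rule LeastI)
  \<comment> \<open>The 20 in \<open>p\<close> is chosen so that \<open>16 * 6^3 \<le> 20^3\<close>,
    which yields \<open>q > 6 * n\<close>.\<close>
  have "(16 * 6 ^ 3) * n ^ 3 \<le> 20 ^ 3 * n ^ 3" by (intro mult_right_mono) auto
  also have "\<dots> = (n * 20) ^ 3" by (simp add: power_mult_distrib)
  also have "\<dots> \<le> p ^ 3" unfolding p_def by (intro power_mono) auto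
  also have "\<dots> \<le> M * p ^ 3" using \<open>M > 0\<close> by simp
  finally have low: "16 * (6 * n) ^ 3 \<le> M * p ^ 3" by (simp add: power_mult_distrib)
  with ub have "(6 * n) ^ 3 < q ^ 3" by linarith
  then have q6: "6 * n < q" by (rule power_less_imp_less_base) simp
  then have "j \<noteq> 0" using \<open>n > 0\<close> by (intro notI) (simp add: q_def)
  then obtain i where i: "j = Suc i" using not0_implies_Suc by blast
  have "\<not> M * p ^ 3 < 16 * (n * i + 1) ^ 3"
    by (rule not_less_Least) (use i in \<open>auto simp: j_def\<close>)
  then have lb: "16 * (n * i + 1) ^ 3 \<le> M * p ^ 3" by simp
  \<comment> \<open>Here \<open>n * i + 1 = q - n\<close>, and
    \<open>(6/5)^3 = 216/125 < 16/9\<close>.\<close>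
  have "5 * q < 6 * (n * i + 1)" using q6 by (simp add: q_def i mult.commute)
  then have "(5 * q) ^ 3 < (6 * (n * i + 1)) ^ 3" by (intro power_strict_mono) auto
  then have "125 * q ^ 3 < 216 * (n * i + 1) ^ 3" by (simp only: power_mult_distrib) simp
  then have "9 * q ^ 3 < 16 * (n * i + 1) ^ 3" by linarith
  with lb have "9 * q ^ 3 < M * p ^ 3" by linarith
  with ub show ?thesis
    using coprime_Suc_mult_left[of n 20] coprime_Suc_mult_left[of n j]
    by (intro exI[of _ p] exI[of _ q]) (auto simp: p_def q_def)
qed

text \<open>Writing \<open>s^3 = n^2 * K + M\<close> splits \<open>n * s^3 * (p * d)^3\<close> into
  \<open>K\<close> equal cubes \<open>(n * p * d)^3\<close> and the remainder
  \<open>A * d^3\<close>, which Ryley's identity makes three cubes.\<close>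

lemma cube_sum_multiple:
  fixes n k :: nat
  assumes "n > 0" "\<not> 3 dvd n" "k \<ge> 3"
  shows "\<exists>D>0. coprime D n \<and> cube_sum k (n * D ^ 3)"
proof -
  define K s where "K = k - 3" and "s = n * K + 1"
  have k: "k = K + 3" using assms by (simp add: K_def)
  have "n ^ 2 * K < s ^ 3"
  proof (cases "K = 0")
    case False
    then have "n ^ 2 * K \<le> (n * K) ^ 2" by (simp add: power_mult_distrib power2_eq_square)
    also have "\<dots> < s ^ 2" unfolding s_def by (intro power_strict_mono) auto
    also have "\<dots> \<le> s ^ 3" by (intro power_increasing) (auto simp: s_def)
    finally show ?thesis .
  qed (simp add: s_def)
  then obtain M where M: "s ^ 3 = n ^ 2 * K + M" "M > 0"
    using less_imp_add_positive by metis
  obtain p q where pq: "p > 0" "q > 0" "coprime p n" "coprime q n"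
      "9 * q ^ 3 < n * M * p ^ 3" "n * M * p ^ 3 < 16 * q ^ 3"
    using ex_coprime_cube_ratio[of "n * M" n] assms M by auto
  define A where "A = n * M * p ^ 3"
  define Q where "Q = A ^ 2 + 9 * A * q ^ 3 + 81 * (q ^ 3) ^ 2"
  \<comment> \<open>Chosen so that \<open>d^3 = (q^3)^2 * (9 * Q)^3\<close>, matching Ryley's
    identity at \<open>B = q^3\<close>.\<close>
  define d where "d = 9 * q ^ 2 * Q"
  obtain x y z where xyz: "x > 0" "y > 0" "z > 0" "A * (q ^ 3) ^ 2 * (9 * Q) ^ 3 = x ^ 3 + y ^ 3 + z ^ 3"
    using ryley_identity[of "q ^ 3" A] pq by (auto simp: A_def Q_def)
  \<comment> \<open>As \<open>n\<close> divides \<open>A\<close>, \<open>Q\<close> is congruent to \<open>81 q\<^sup>6\<close> modulo \<open>n\<close>; this is where 3 must not divide \<open>n\<close>.\<close>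
  define D where "D = s * p * d"
  have "coprime 3 n" using assms by (simp add: prime_imp_coprime)
  then have c9: "coprime (9::nat) n" and c81: "coprime (81::nat) n"
    using coprime_power_left_iff[of "3::nat" 2 n] coprime_power_left_iff[of "3::nat" 4 n] by auto
  have "Q = n * (M * p ^ 3 * (A + 9 * q ^ 3)) + 81 * (q ^ 3) ^ 2"
    by (simp add: Q_def A_def power2_eq_square algebra_simps)
  moreover have "coprime (81 * (q ^ 3) ^ 2) n" using c81 pq by simp
  ultimately have "coprime Q n"
    by (metis coprime_iff_gcd_eq_1 gcd_add_mult gcd.commute mult.commute)
  moreover have "coprime s n" unfolding s_def by (rule coprime_Suc_mult_left)
  ultimately have "coprime D n"
    using c9 pq by (simp add: D_def d_def)
  have "D > 0" using pq by (simp add: D_def d_def Q_def s_def)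
  have "n * D ^ 3 = n * s ^ 3 * (p * d) ^ 3" by (simp add: D_def power_mult_distrib)
  also have "\<dots> = K * (n * p * d) ^ 3 + A * d ^ 3"
    unfolding M A_def by (simp add: power_mult_distrib algebra_simps power3_eq_cube power2_eq_square)
  also have "A * d ^ 3 = A * (q ^ 3) ^ 2 * (9 * Q) ^ 3"
    by (simp add: d_def power_mult_distrib flip: power_mult)
  finally have "n * D ^ 3 = K * (n * p * d) ^ 3 + x ^ 3 + y ^ 3 + z ^ 3"
    using xyz by simp
  moreover have "n * p * d > 0" using assms pq by (simp add: d_def Q_def)
  ultimately have "cube_sum k (n * D ^ 3)"
    unfolding k using xyz by (simp add: cube_sum_add3 cube_sum_replicate)
  with \<open>coprime D n\<close> \<open>D > 0\<close> show ?thesis by blast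
qed

text \<open>Next to \<open>K\<close> copies of \<open>3^3\<close>, three cubes with sum 10, 3 or 36
  give 3-adic valuation 0, 1 or 2; scaling by \<open>(3^f)^3\<close> reaches every
  \<open>e\<close>.\<close>

lemma cube_sum_exact_power_of_3:
  fixes k e :: nat
  assumes "k \<ge> 3"
  shows "\<exists>m>0. \<not> 3 dvd m \<and> cube_sum k (3 ^ e * m)"
proof -
  define K f where "K = k - 3" and "f = e div 3"
  have k: "k = K + 3" using assms by (simp add: K_def)
  have cs: "cube_sum k ((27 * K + x ^ 3 + y ^ 3 + z ^ 3) * (3 ^ f) ^ 3)" if "x > 0" "y > 0" "z > 0" for x y z
    unfolding k by (intro cube_sum_scale cube_sum_add3 that) (use cube_sum_replicate[of 3 K] in \<open>simp_all add: mult.commute\<close>)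
  have e: "e = 3 * f + e mod 3" by (simp add: f_def)
  consider "e mod 3 = 0" | "e mod 3 = 1" | "e mod 3 = 2" by linarith
  then show ?thesis
  proof cases
    case 1
    then have "(27 * K + 1 ^ 3 + 1 ^ 3 + 2 ^ 3) * (3 ^ f) ^ 3 = 3 ^ e * (27 * K + 10)"
      by (subst e) (simp add: mult.commute flip: power_mult)
    moreover have "\<not> 3 dvd 27 * K + 10" by presburger
    ultimately show ?thesis using cs[of 1 1 2] by (intro exI[of _ "27 * K + 10"]) simp
  next
    case 2
    then have "(27 * K + 1 ^ 3 + 1 ^ 3 + 1 ^ 3) * (3 ^ f) ^ 3 = 3 ^ e * (9 * K + 1)"
      by (subst e) (simp add: power_add mult.commute flip: power_mult)
    moreover have "\<not> 3 dvd 9 * K + 1" by presburger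
    ultimately show ?thesis using cs[of 1 1 1] by (intro exI[of _ "9 * K + 1"]) simp
  next
    case 3
    then have "(27 * K + 1 ^ 3 + 2 ^ 3 + 3 ^ 3) * (3 ^ f) ^ 3 = 3 ^ e * (3 * K + 4)"
      by (subst e) (simp add: power_add mult.commute flip: power_mult)
    moreover have "\<not> 3 dvd 3 * K + 4" by presburger
    ultimately show ?thesis using cs[of 1 2 3] by (intro exI[of _ "3 * K + 4"]) simp
  qed
qed

section \<open>From the cubes of the values to the values of \<open>g\<close>\<close>

theorem theorem6p2:
  fixes k :: nat and g :: "nat \<Rightarrow> complex"
  assumes "k \<ge> 3"
    and "multiplicative g"
    and "\<And>a :: nat \<Rightarrow> nat. (\<And>i. i \<in> {1..k} \<Longrightarrow> a i > 0) \<Longrightarrow>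
           g (\<Sum>i = 1..k. a i ^ 3) = (\<Sum>i = 1..k. g (a i) ^ 3)"
  shows "\<forall>n > 0. g n = of_nat n"
proof -
  have g1: "g 1 = 1" and mult: "\<And>m n. m > 0 \<Longrightarrow> n > 0 \<Longrightarrow> coprime m n \<Longrightarrow> g (m * n) = g m * g n"
    using assms(2) by (auto simp: multiplicative_def)
  define G where "G = (\<lambda>n. g n ^ 3)"
  have K: "{1..k} = insert 1 (insert 2 (insert 3 {4..k}))" using assms(1) by auto
  have three: "g (a ^ 3 + b ^ 3 + c ^ 3 + (k - 3)) = G a + G b + G c + of_nat (k - 3)"
    if "a > 0" "b > 0" "c > 0" for a b c
  proof -
    define h where "h i = (if i = 1 then a else if i = 2 then b else if i = 3 then c else 1)" for i :: nat
    have "(\<Sum>i = 4..k. h i ^ 3) = (\<Sum>i = 4..k. 1)" "(\<Sum>i = 4..k. g (h i) ^ 3) = (\<Sum>i = 4..k. 1)"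
      by (rule sum.cong; use g1 in \<open>simp add: h_def\<close>)+
    then have "(\<Sum>i = 1..k. h i ^ 3) = a ^ 3 + b ^ 3 + c ^ 3 + (k - 3)"
      "(\<Sum>i = 1..k. g (h i) ^ 3) = G a + G b + G c + of_nat (k - 3)"
      unfolding K by (simp_all add: h_def G_def)
    then show ?thesis using assms(3)[of h] that by (simp add: h_def)
  qed
  have "respects_cube_relations G"
    unfolding respects_cube_relations_def using three by (metis add_right_cancel)
  moreover have "G 1 = 1" using g1 by (simp add: G_def)
  moreover have "G (m * n) = G m * G n" if "m > 0" "n > 0" "coprime m n" for m n
    using mult[OF that] by (simp add: G_def power_mult_distrib)
  ultimately consider "\<forall>n>0. G n = of_nat n ^ 3" | "\<forall>n>0. norm (G n) \<le> 1"
    using multiplicative_respects_cube_relations[of G] by blast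
  then have G: "\<forall>n>0. G n = of_nat n ^ 3"
  proof cases
    case 2
    have "g k = of_nat k" using assms(3)[of "\<lambda>_. 1"] g1 by simp
    then have "norm (G k) = real k ^ 3" by (simp add: G_def norm_power)
    moreover have "real k ^ 3 > 1" using assms(1) by (intro one_less_power) auto
    ultimately show ?thesis using 2 assms(1) by (metis not_less less_le_trans zero_less_numeral)
  qed
  have id: "g s = of_nat s" if "cube_sum k s" for s
  proof -
    obtain a where a: "\<forall>i\<in>{1..k}. a i > 0" "s = (\<Sum>i = 1..k. a i ^ 3)"
      using cube_sum_imp_ex_function[OF \<open>cube_sum k s\<close>] by blast
    have "g s = (\<Sum>i = 1..k. g (a i) ^ 3)" unfolding a(2) by (rule assms(3)) (use a in auto)
    also have "\<dots> = (\<Sum>i = 1..k. of_nat (a i) ^ 3)"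
      by (rule sum.cong) (use a G in \<open>auto simp: G_def\<close>)
    finally show ?thesis using a by simp
  qed
  have id_cancel: "g n = of_nat n" if "g (n * m) = of_nat (n * m)" "g m = of_nat m" "n > 0" "m > 0" "coprime n m" for n m
    using mult[of n m] that by simp
  have coprime3: "g n = of_nat n" if n: "n > 0" "\<not> 3 dvd n" for n
  proof -
    obtain D where D: "D > 0" "coprime D n" "cube_sum k (n * D ^ 3)"
      using cube_sum_multiple[OF n assms(1)] by blast
    obtain j where j: "cube_sum k ((3 ^ j) ^ 3)"
      using cube_sum_power_of_3_cubed[OF assms(1)] by blast
    \<comment> \<open>Both \<open>m\<close> and \<open>n * m\<close> are cubes times known sums of
      \<open>k\<close> cubes: \<open>m\<close> scales \<open>(3^j)^3\<close>, and
      \<open>n * m\<close> scales \<open>n * D^3\<close>.\<close>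
    define m where "m = (3 ^ j) ^ 3 * D ^ 3"
    have "cube_sum k m" "cube_sum k (n * m)"
      using cube_sum_scale[OF j D(1)] cube_sum_scale[OF D(3), of "3 ^ j"]
      by (simp_all add: m_def mult_ac)
    moreover have "coprime 3 n" using n by (simp add: prime_imp_coprime)
    then have "coprime m n" using D(2) by (simp add: m_def)
    ultimately show ?thesis using id_cancel[of n m] id n D by (simp add: m_def coprime_commute)
  qed
  \<comment> \<open>The cofactor \<open>m\<close> is prime to 3, so \<open>coprime3\<close> supplies
    its value.\<close>
  have power3: "g (3 ^ e) = of_nat (3 ^ e)" for e
  proof -
    obtain m where m: "m > 0" "\<not> 3 dvd m" "cube_sum k (3 ^ e * m)"
      using cube_sum_exact_power_of_3[OF assms(1)] by blast
    moreover have "coprime (3 ^ e) m" using m by (simp add: prime_imp_coprime)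
    ultimately show ?thesis using id_cancel[of "3 ^ e" m] id coprime3 by simp
  qed
  show ?thesis
  proof (intro allI impI)
    fix n :: nat assume "n > 0"
    then obtain e m where n: "\<not> 3 dvd m" "n = m * 3 ^ e"
      using prime_power_canonical[of 3 n] by auto
    then have "m > 0" using \<open>n > 0\<close> by simp
    moreover have "coprime (3 ^ e) m" using n by (simp add: prime_imp_coprime)
    ultimately show "g n = of_nat n"
      using mult[of "3 ^ e" m] coprime3[of m] power3[of e] n by (simp add: mult.commute)
  qed
qed

end
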